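(* Let $F=(\mathbb{R}^d,\|\cdot\|_F)$ be a polyhedral Banach space and $E\subset F$ a linear subspace with $E\neq\{0\}$ and $E\ne F$; let $n=\dim E$. Let $u_1,\dots,u_n\in\mathbb{R}^d$ be an orthonormal basis of $E\subset\mathbb{R}^d$ and $v_1,\dots,v_{d-n}\in\mathbb{R}^d$ an orthonormal basis of its orthogonal complement (with respect to the standard inner product). Fix an enumeration $\{B_1,\dots,B_p\}$ of the set of $d\times d$ matrices $$\{u_ru_{r'}^T: 1\le r,r'\le n\}\cup\{v_sv_{s'}^T: 1\le s,s'\le d-n\}\cup\{u_rv_s^T: 1\le r\le n,\ 1\le s\le d-n\}$$ such that $B_i=u_iu_i^T$ for all $i=1,\dots,n$, and fix an enumeration $\{E_1,\dots,E_q\}$ of the extreme points of the closed unit ball of $\mathcal{L}(F)$. Define the matrix $A\in\mathcal{M}_{p\times q}(\mathbb{R})$ by $a_{ij}=\operatorname{tr}(B_iE_j)$ and the vector $b\in\mathbb{R}^p$ by $b_i=1$ for $i=1,\dots,n$ and $b_i=0$ otherwise. Let $j\in\mathbb{R}^q$ denote the all-ones vector. Then the linear programming problem $$\text{minimize } j^Tx\quad\text{subject to } Ax=b,\ x\ge 0 \qquad (x\in\mathbb{R}^q)$$ is solvable and its optimal value is equal to $\lambda(E,F)$.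
   Context: A finite-dimensional real Banach space $F$ is polyhedral if the closed unit ball of its dual $F^\ast$ has finitely many extreme points. $\mathcal{L}(F)$ is the space of real $d\times d$ matrices, viewed as linear operators $F\to F$, with the operator norm induced by $\|\cdot\|_F$; for polyhedral $F$ its closed unit ball has finitely many extreme points. For Banach spaces $E\subset F$, $\lambda(E,F)$ is the infimum of the norms of all linear projections from $F$ onto $E$. $\mathcal{M}_{p\times q}(\mathbb{R})$ denotes the real $p\times q$ matrices and $x\ge0$ is meant coordinatewise. *)

theory Defs
  imports "HOL-Analysis.Analysis"
begin

definition is_norm :: "('a::real_vector \<Rightarrow> real) \<Rightarrow> bool" where
  "is_norm N \<longleftrightarrow>
     (\<forall>x. N x = 0 \<longleftrightarrow> x = 0) \<and>
     (\<forall>c x. N (c *\<^sub>R x) = \<bar>c\<bar> * N x) \<and>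
     (\<forall>x y. N (x + y) \<le> N x + N y)"

(* Operator norm of f from (_, N) to (_, M). It is meant for linear maps on
   finite-dimensional spaces, where the set of values is bounded above. *)
definition op_norm :: "('a::real_vector \<Rightarrow> real) \<Rightarrow> ('b::real_vector \<Rightarrow> real) \<Rightarrow> ('a \<Rightarrow> 'b) \<Rightarrow> real" where
  "op_norm N M f = (SUP x\<in>{x. N x \<le> 1}. M (f x))"

(* The type (real^'d) =>L real contains every linear functional, by finite dimensionality.
   The Euclidean norm that this type carries is not used: the dual norm is taken
   with respect to N. *)
definition dual_unit_ball :: "(real^'d \<Rightarrow> real) \<Rightarrow> ((real^'d) \<Rightarrow>\<^sub>L real) set" where
  "dual_unit_ball N = {f. op_norm N abs (blinfun_apply f) \<le> 1}"

definition polyhedral_norm :: "(real^'d \<Rightarrow> real) \<Rightarrow> bool" where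
  "polyhedral_norm N \<longleftrightarrow> is_norm N \<and> finite {f. f extreme_point_of dual_unit_ball N}"

definition operator_unit_ball :: "(real^'d \<Rightarrow> real) \<Rightarrow> (real^'d^'d) set" where
  "operator_unit_ball N = {X. op_norm N N ((*v) X) \<le> 1}"

definition is_projection_onto :: "('a::real_vector \<Rightarrow> 'a) \<Rightarrow> 'a set \<Rightarrow> bool" where
  "is_projection_onto P E \<longleftrightarrow> linear P \<and> P \<circ> P = P \<and> range P = E"

definition projection_constant :: "('a::real_vector \<Rightarrow> real) \<Rightarrow> 'a set \<Rightarrow> real" where
  "projection_constant N E = (INF P\<in>{P. is_projection_onto P E}. op_norm N N P)"

definition orthonormal_basis :: "(nat \<Rightarrow> 'a::real_inner) \<Rightarrow> nat \<Rightarrow> 'a set \<Rightarrow> bool" where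
  "orthonormal_basis u n V \<longleftrightarrow>
     (\<forall>i\<in>{1..n}. \<forall>j\<in>{1..n}. u i \<bullet> u j = (if i = j then 1 else 0)) \<and> span (u ` {1..n}) = V"

(* The matrix x y^T. The type constraint makes the inner dimension 1;
   columnvector and rowvector leave it polymorphic. *)
definition outer :: "real^'m \<Rightarrow> real^'n \<Rightarrow> real^'n^'m" where
  "outer x y = (columnvector x :: real^1^'m) ** rowvector y"

(* The linear program: minimize c^T x subject to A x = b, x >= 0. Vectors of R^q and p x q
   matrices are functions on indices starting at 1; only the values on {1..q} and
   {1..p} x {1..q} are ever used. *)
definition lp_objective :: "nat \<Rightarrow> (nat \<Rightarrow> real) \<Rightarrow> (nat \<Rightarrow> real) \<Rightarrow> real" where
  "lp_objective q c x = (\<Sum>k=1..q. c k * x k)"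

definition lp_feasible :: "nat \<Rightarrow> nat \<Rightarrow> (nat \<Rightarrow> nat \<Rightarrow> real) \<Rightarrow> (nat \<Rightarrow> real) \<Rightarrow> (nat \<Rightarrow> real) set" where
  "lp_feasible p q A b =
     {x. (\<forall>i\<in>{1..p}. (\<Sum>k=1..q. A i k * x k) = b i) \<and> (\<forall>k\<in>{1..q}. 0 \<le> x k)}"

definition lp_solvable :: "nat \<Rightarrow> nat \<Rightarrow> (nat \<Rightarrow> nat \<Rightarrow> real) \<Rightarrow> (nat \<Rightarrow> real) \<Rightarrow> (nat \<Rightarrow> real) \<Rightarrow> bool" where
  "lp_solvable p q A b c \<longleftrightarrow>
     (\<exists>x\<in>lp_feasible p q A b. \<forall>y\<in>lp_feasible p q A b. lp_objective q c x \<le> lp_objective q c y)"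

definition lp_value :: "nat \<Rightarrow> nat \<Rightarrow> (nat \<Rightarrow> nat \<Rightarrow> real) \<Rightarrow> (nat \<Rightarrow> real) \<Rightarrow> (nat \<Rightarrow> real) \<Rightarrow> real" where
  "lp_value p q A b c = (INF x\<in>lp_feasible p q A b. lp_objective q c x)"

end

theory Submission
  imports Defs
begin

text \<open>
  A nonnegative vector \<open>x\<close> is sent to the matrix \<open>X = (\<Sum>k. x\<^sub>k E\<^sub>k)\<close>. Since
  \<open>tr (y z\<^sup>T X) = z \<bullet> X y\<close>, the linear constraints speak only about \<open>X\<close>. They prescribe the blocks
  \<open>E \<rightarrow> E\<close> (the identity), \<open>E \<rightarrow> E\<^sup>\<bottom>\<close> (zero) and \<open>E\<^sup>\<bottom> \<rightarrow> E\<^sup>\<bottom>\<close> (zero) of \<open>X\<close> and leave the block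
  \<open>E\<^sup>\<bottom> \<rightarrow> E\<close> free, which is to say that \<open>X\<close> is a projection onto \<open>E\<close>
  (\<open>projection_iff_orthonormal_entries\<close>).

  The objective is tied to the operator norm by the theorem of Minkowski: the unit ball is the convex
  hull of the \<open>E\<^sub>k\<close>, so the norm of \<open>X\<close> is the least total weight \<open>\<Sum>k. x\<^sub>k\<close> of a nonnegative
  combination of the \<open>E\<^sub>k\<close> that yields \<open>X\<close> (\<open>norm_le_weight\<close>, \<open>norm_eq_weight\<close>). Minimizing first
  over the combinations of a fixed \<open>X\<close> and then over \<open>X\<close>, the program becomes the search for a projection of
  least norm. The projections onto \<open>E\<close> form a nonempty closed set, so by coercivity of norms in finite
  dimension a projection of least norm exists (\<open>norm_attains_min_on_closed\<close>), and any of its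
  representations of least weight solves the program.
\<close>

section \<open>Norms on a Euclidean space\<close>

lemma is_norm_zero: "is_norm N \<Longrightarrow> N x = 0 \<longleftrightarrow> x = 0"
  and is_norm_scale: "is_norm N \<Longrightarrow> N (c *\<^sub>R x) = \<bar>c\<bar> * N x"
  and is_norm_triangle: "is_norm N \<Longrightarrow> N (x + y) \<le> N x + N y"
  unfolding is_norm_def by blast+

lemma is_norm_nonneg:
  assumes "is_norm N" shows "0 \<le> N x"
proof -
  have "N (x + (-1) *\<^sub>R x) \<le> N x + N ((-1) *\<^sub>R x)"
    by (rule is_norm_triangle[OF assms])
  then show ?thesis
    using is_norm_zero[OF assms, of 0] is_norm_scale[OF assms, of "-1" x] by simp
qed

lemma is_norm_sum:
  assumes "is_norm N" shows "N (sum f S) \<le> (\<Sum>i\<in>S. N (f i))"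
proof (induction S rule: infinite_finite_induct)
  case (insert i S)
  then show ?case using is_norm_triangle[OF assms, of "f i" "sum f S"] by simp
qed (simp_all add: is_norm_zero[OF assms, THEN iffD2])

lemma is_norm_convex_on:
  assumes "is_norm N" shows "convex_on UNIV N"
proof (rule convex_onI)
  fix t x y assume "0 < t" "t < (1::real)"
  then show "N ((1 - t) *\<^sub>R x + t *\<^sub>R y) \<le> (1 - t) * N x + t * N y"
    using is_norm_triangle[OF assms, of "(1 - t) *\<^sub>R x" "t *\<^sub>R y"]
    by (simp add: is_norm_scale[OF assms])
qed simp

lemma is_norm_continuous_on:
  fixes N :: "'a::euclidean_space \<Rightarrow> real"
  assumes "is_norm N" shows "continuous_on S N"
  using convex_on_continuous[OF open_UNIV is_norm_convex_on[OF assms]]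
  by (rule continuous_on_subset) simp

lemma is_norm_coercive:
  fixes N :: "'a::euclidean_space \<Rightarrow> real"
  assumes "is_norm N"
  obtains c where "c > 0" "\<And>x. c * norm x \<le> N x"
proof -
  obtain a where a: "a \<in> sphere (0::'a) 1" "\<And>y. y \<in> sphere 0 1 \<Longrightarrow> N a \<le> N y"
    using continuous_attains_inf[OF compact_sphere _ is_norm_continuous_on[OF assms], of "0::'a" 1]
    by auto
  have "N a * norm x \<le> N x" for x
  proof (cases "x = 0")
    case False
    then have "N a \<le> N ((1 / norm x) *\<^sub>R x)" by (intro a(2)) simp
    with False show ?thesis by (simp add: is_norm_scale[OF assms] field_simps)
  qed (simp add: is_norm_nonneg[OF assms])
  moreover have "N a > 0"
    using a(1) is_norm_nonneg[OF assms, of a] is_norm_zero[OF assms, of a] by force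
  ultimately show ?thesis using that by blast
qed

lemma is_norm_compact_ball:
  fixes N :: "'a::euclidean_space \<Rightarrow> real"
  assumes "is_norm N" shows "compact {x. N x \<le> r}"
proof -
  obtain c where c: "c > 0" "\<And>x. c * norm x \<le> N x"
    using is_norm_coercive[OF assms] by blast
  have "norm x \<le> r / c" if "N x \<le> r" for x
    using order_trans[OF c(2) that] c(1) by (simp add: field_simps)
  then have "bounded {x. N x \<le> r}" by (auto simp: bounded_iff)
  moreover have "closed {x. N x \<le> r}"
    by (intro closed_Collect_le is_norm_continuous_on[OF assms] continuous_on_const)
  ultimately show ?thesis by (simp add: compact_eq_bounded_closed)
qed

text \<open>
  Coercivity makes the part of \<open>C\<close> that competes with a given point \<open>z\<close> compact.
\<close>

lemma norm_attains_min_on_closed: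
  fixes N :: "'a::euclidean_space \<Rightarrow> real"
  assumes "is_norm N" "closed C" "C \<noteq> {}"
  obtains x where "x \<in> C" "\<And>y. y \<in> C \<Longrightarrow> N x \<le> N y"
proof -
  obtain z where z: "z \<in> C" using assms(3) by blast
  have "compact (C \<inter> {x. N x \<le> N z})"
    by (intro closed_Int_compact assms is_norm_compact_ball)
  then obtain x where x: "x \<in> C" "N x \<le> N z" "\<And>y. y \<in> C \<Longrightarrow> N y \<le> N z \<Longrightarrow> N x \<le> N y"
    using continuous_attains_inf[of "C \<inter> {x. N x \<le> N z}" N] z is_norm_continuous_on[OF assms(1)]
    by auto
  show ?thesis
    using that[OF x(1)] x(2,3) by (meson linear order_trans)
qed

section \<open>A norm as the least weight of a combination of extreme points\<close>

lemma norm_le_weight: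
  assumes "is_norm N" "\<And>k. k \<in> I \<Longrightarrow> N (e k) \<le> 1" "\<And>k. k \<in> I \<Longrightarrow> 0 \<le> x k"
  shows "N (\<Sum>k\<in>I. x k *\<^sub>R e k) \<le> sum x I"
proof -
  have "N (\<Sum>k\<in>I. x k *\<^sub>R e k) \<le> (\<Sum>k\<in>I. N (x k *\<^sub>R e k))"
    by (rule is_norm_sum[OF assms(1)])
  also have "\<dots> \<le> sum x I"
    by (rule sum_mono) (simp add: is_norm_scale[OF assms(1)] assms(2,3) mult_left_le)
  finally show ?thesis .
qed

text \<open>
  A nonzero vector, scaled to norm one, lies in the unit ball, and by Minkowski's theorem it is a
  convex combination of extreme points; scaling back gives weights of total \<open>N X\<close>.
\<close>

lemma norm_eq_weight:
  fixes N :: "'a::euclidean_space \<Rightarrow> real"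
  assumes N: "is_norm N" and "finite I"
    and e: "bij_betw e I {z. z extreme_point_of {y. N y \<le> 1}}"
  obtains x where "\<And>k. k \<in> I \<Longrightarrow> 0 \<le> x k" "(\<Sum>k\<in>I. x k *\<^sub>R e k) = X" "sum x I = N X"
proof (cases "X = 0")
  case True
  then show ?thesis using that[of "\<lambda>_. 0"] is_norm_zero[OF N] by simp
next
  case False
  let ?ext = "{z. z extreme_point_of {y. N y \<le> 1}}"
  have pos: "N X > 0"
    using False is_norm_nonneg[OF N, of X] is_norm_zero[OF N, of X] by simp
  have "convex {y. N y \<le> 1}"
  proof (rule convexI, unfold mem_Collect_eq)
    fix y z and s t :: real
    assume yz: "N y \<le> 1" "N z \<le> 1" "0 \<le> s" "0 \<le> t" "s + t = 1"
    have "N (s *\<^sub>R y + t *\<^sub>R z) \<le> s * N y + t * N z"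
      using is_norm_triangle[OF N, of "s *\<^sub>R y" "t *\<^sub>R z"] yz(3,4)
      by (simp add: is_norm_scale[OF N])
    also have "\<dots> \<le> 1" using yz by (rule convex_bound_le)
    finally show "N (s *\<^sub>R y + t *\<^sub>R z) \<le> 1" .
  qed
  then have hull: "{y. N y \<le> 1} = convex hull ?ext"
    by (intro Krein_Milman_Minkowski is_norm_compact_ball[OF N])
  have "(1 / N X) *\<^sub>R X \<in> {y. N y \<le> 1}"
    using pos by (simp add: is_norm_scale[OF N])
  then have "(1 / N X) *\<^sub>R X \<in> convex hull ?ext"
    using hull by (rule back_subst[of "\<lambda>S. _ \<in> S"])
  moreover have "finite ?ext" using e \<open>finite I\<close> bij_betw_finite by blast
  ultimately obtain w where w: "\<And>z. z \<in> ?ext \<Longrightarrow> 0 \<le> w z" "sum w ?ext = 1"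
      "(\<Sum>z\<in>?ext. w z *\<^sub>R z) = (1 / N X) *\<^sub>R X"
    using convex_hull_finite[of ?ext] by auto
  show ?thesis
  proof (rule that[of "\<lambda>k. N X * w (e k)"])
    show "0 \<le> N X * w (e k)" if "k \<in> I" for k
      using w(1)[OF bij_betw_apply[OF e that]] pos by simp
    have "(\<Sum>k\<in>I. (N X * w (e k)) *\<^sub>R e k) = N X *\<^sub>R (\<Sum>k\<in>I. w (e k) *\<^sub>R e k)"
      by (simp add: scaleR_sum_right)
    also have "\<dots> = X"
      using sum.reindex_bij_betw[OF e, of "\<lambda>z. w z *\<^sub>R z"] w(3) pos by simp
    finally show "(\<Sum>k\<in>I. (N X * w (e k)) *\<^sub>R e k) = X" .
    show "(\<Sum>k\<in>I. N X * w (e k)) = N X"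
      using sum.reindex_bij_betw[OF e, of w] w(2) by (simp flip: sum_distrib_left)
  qed
qed

section \<open>The operator norm on matrices\<close>

lemma op_norm_bdd_above:
  fixes N :: "real^'d \<Rightarrow> real" and X :: "real^'d^'d"
  assumes "is_norm N" shows "bdd_above ((\<lambda>x. N (X *v x)) ` {x. N x \<le> 1})"
proof -
  have "continuous_on {x. N x \<le> 1} (\<lambda>x. N (X *v x))"
    by (rule continuous_on_compose2[OF is_norm_continuous_on[OF assms, of UNIV]])
       (auto intro!: linear_continuous_on linear_conv_bounded_linear[THEN iffD1])
  then show ?thesis
    by (intro bounded_imp_bdd_above compact_imp_bounded compact_continuous_image
        is_norm_compact_ball[OF assms])
qed

lemma op_norm_bound:
  fixes N :: "real^'d \<Rightarrow> real" and X :: "real^'d^'d"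
  assumes N: "is_norm N" shows "N (X *v x) \<le> op_norm N N ((*v) X) * N x"
proof (cases "x = 0")
  case False
  then have pos: "N x > 0"
    using is_norm_nonneg[OF N, of x] is_norm_zero[OF N, of x] by simp
  have "N (X *v ((1 / N x) *\<^sub>R x)) \<le> op_norm N N ((*v) X)"
    unfolding op_norm_def using pos
    by (intro cSUP_upper op_norm_bdd_above[OF N]) (simp add: is_norm_scale[OF N])
  with pos show ?thesis
    by (simp add: matrix_vector_mult_scaleR is_norm_scale[OF N] field_simps)
qed (simp add: is_norm_zero[OF N, THEN iffD2])

lemma op_norm_le:
  assumes "is_norm N" "\<And>x. N x \<le> 1 \<Longrightarrow> N (f x) \<le> r"
  shows "op_norm N N f \<le> r"
proof -
  have "N 0 \<le> 1" using is_norm_zero[OF assms(1), of 0] by simp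
  then show ?thesis unfolding op_norm_def by (intro cSUP_least) (use assms(2) in auto)
qed

lemma op_norm_nonneg:
  fixes N :: "real^'d \<Rightarrow> real" and X :: "real^'d^'d"
  assumes "is_norm N" shows "0 \<le> op_norm N N ((*v) X)"
proof -
  have "N (X *v 0) \<le> op_norm N N ((*v) X)"
    unfolding op_norm_def
    by (intro cSUP_upper op_norm_bdd_above[OF assms]) (simp add: is_norm_zero[OF assms, THEN iffD2])
  then show ?thesis by (simp add: is_norm_zero[OF assms, THEN iffD2])
qed

lemma is_norm_op_norm:
  fixes N :: "real^'d \<Rightarrow> real"
  assumes N: "is_norm N" shows "is_norm (\<lambda>X::real^'d^'d. op_norm N N ((*v) X))"
proof -
  let ?M = "\<lambda>X::real^'d^'d. op_norm N N ((*v) X)"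
  note bound = op_norm_bound[OF N] and nonneg = op_norm_nonneg[OF N]
  have M_le: "N (X *v x) \<le> ?M X" if "N x \<le> 1" for X x
    using bound[of X x] mult_left_le[OF that nonneg[of X]] by linarith
  have zero: "?M X = 0 \<longleftrightarrow> X = 0" for X
  proof
    assume "?M X = 0"
    then have "N (X *v x) = 0" for x
      using bound[of X x] is_norm_nonneg[OF N, of "X *v x"] by simp
    then show "X = 0" by (simp add: is_norm_zero[OF N] matrix_eq)
  next
    assume "X = 0"
    then show "?M X = 0"
      using nonneg[of X] op_norm_le[OF N, of "(*v) X" 0] is_norm_zero[OF N, of 0] by auto
  qed
  have scale_le: "?M (c *\<^sub>R X) \<le> \<bar>c\<bar> * ?M X" for c X
    by (rule op_norm_le[OF N])
       (simp add: scaleR_matrix_vector_assoc[symmetric] is_norm_scale[OF N] M_le mult_left_mono)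
  have scale: "?M (c *\<^sub>R X) = \<bar>c\<bar> * ?M X" for c X
  proof (cases "c = 0")
    case False
    have "?M X \<le> \<bar>1 / c\<bar> * ?M (c *\<^sub>R X)"
      using scale_le[of "1 / c" "c *\<^sub>R X"] False by simp
    with False have "\<bar>c\<bar> * ?M X \<le> ?M (c *\<^sub>R X)" by (simp add: field_simps)
    with scale_le[of c X] show ?thesis by simp
  qed (simp add: zero[THEN iffD2])
  have "?M (X + Y) \<le> ?M X + ?M Y" for X Y
  proof (rule op_norm_le[OF N])
    fix x assume "N x \<le> 1"
    then show "N ((X + Y) *v x) \<le> ?M X + ?M Y"
      using is_norm_triangle[OF N, of "X *v x" "Y *v x"] M_le[of x X] M_le[of x Y]
      by (simp add: matrix_vector_mult_add_rdistrib)
  qed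
  with zero scale show ?thesis unfolding is_norm_def by blast
qed

section \<open>Projections onto a subspace\<close>

lemma is_projection_onto_iff:
  assumes "linear f"
  shows "is_projection_onto f E \<longleftrightarrow> (\<forall>x\<in>E. f x = x) \<and> (\<forall>x. f x \<in> E)"
proof
  assume "is_projection_onto f E"
  then show "(\<forall>x\<in>E. f x = x) \<and> (\<forall>x. f x \<in> E)"
    unfolding is_projection_onto_def by (auto simp: fun_eq_iff)
next
  assume R: "(\<forall>x\<in>E. f x = x) \<and> (\<forall>x. f x \<in> E)"
  then have "E \<subseteq> range f" by (metis rangeI subsetI)
  with R assms show "is_projection_onto f E"
    unfolding is_projection_onto_def by (auto simp: fun_eq_iff)
qed

lemma closed_projection_matrices:
  fixes E :: "(real^'d) set"
  assumes "subspace E"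
  shows "closed {X::real^'d^'d. is_projection_onto ((*v) X) E}"
proof -
  have cont: "continuous_on UNIV (\<lambda>X::real^'d^'d. X *v x)" for x
    by (intro linear_continuous_on linear_conv_bounded_linear[THEN iffD1] linearI)
       (simp_all add: matrix_vector_mult_add_rdistrib scaleR_matrix_vector_assoc)
  have "{X::real^'d^'d. is_projection_onto ((*v) X) E}
      = (\<Inter>x\<in>E. {X. X *v x = x}) \<inter> (\<Inter>x. (\<lambda>X. X *v x) -` E)"
    by (auto simp: is_projection_onto_iff)
  moreover have "closed {X::real^'d^'d. X *v x = x}" for x
    by (intro closed_Collect_eq cont continuous_on_const)
  moreover have "closed ((\<lambda>X::real^'d^'d. X *v x) -` E)" for x
    by (intro closed_vimage closed_subspace assms cont)
  ultimately show ?thesis by (simp add: closed_Int closed_INT)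
qed

lemma projection_matrix_exists:
  fixes E :: "(real^'d) set"
  assumes "subspace E"
  obtains X :: "real^'d^'d" where "is_projection_onto ((*v) X) E"
proof -
  obtain g :: "real^'d \<Rightarrow> real^'d" where g: "range g \<subseteq> E" "linear g" "\<forall>x\<in>E. g x = x"
    using real_vector.linear_exists_left_inverse_on[OF linear_id assms] by auto
  then have "is_projection_onto g E" by (auto simp: is_projection_onto_iff)
  with g(2) show ?thesis using that[of "matrix g"] by (simp add: matrix_works)
qed

lemma projection_constant_eq_matrix_INF:
  fixes N :: "real^'d \<Rightarrow> real"
  shows "projection_constant N E
    = (INF X\<in>{X::real^'d^'d. is_projection_onto ((*v) X) E}. op_norm N N ((*v) X))"
proof -
  have "P \<in> (\<lambda>X::real^'d^'d. (*v) X) ` {X. is_projection_onto ((*v) X) E}"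
    if "is_projection_onto P E" for P
  proof -
    have "linear P" using that by (simp add: is_projection_onto_def)
    then have "P = (*v) (matrix P)" by (simp add: fun_eq_iff matrix_works)
    with that show ?thesis by (metis image_eqI mem_Collect_eq)
  qed
  then have "{P. is_projection_onto P E} = (\<lambda>X::real^'d^'d. (*v) X) ` {X. is_projection_onto ((*v) X) E}"
    by auto
  then show ?thesis unfolding projection_constant_def by (simp add: image_image)
qed

lemma trace_outer_mult:
  "trace (outer x y ** X) = y \<bullet> (X *v x)"
proof -
  have "trace (outer x y ** X) = (\<Sum>i\<in>UNIV. \<Sum>k\<in>UNIV. x $ i * y $ k * X $ k $ i)"
    by (simp add: trace_def outer_def matrix_matrix_mult_def columnvector_def rowvector_def)
  also have "\<dots> = (\<Sum>k\<in>UNIV. \<Sum>i\<in>UNIV. x $ i * y $ k * X $ k $ i)"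
    by (rule sum.swap)
  also have "\<dots> = y \<bullet> (X *v x)"
    by (simp add: inner_vec_def matrix_vector_mult_def sum_distrib_left ac_simps)
  finally show ?thesis .
qed

lemma outer_mult_vector: "outer x y *v w = (y \<bullet> w) *\<^sub>R x"
  by (simp add: vec_eq_iff outer_def matrix_vector_mult_def matrix_matrix_mult_def columnvector_def
      rowvector_def inner_vec_def sum_distrib_left ac_simps)

lemma mem_if_orthogonal_to_comp_basis:
  fixes E :: "'a::euclidean_space set"
  assumes "subspace E" "orthonormal_basis v m (orthogonal_comp E)"
    and "\<And>s. s \<in> {1..m} \<Longrightarrow> v s \<bullet> x = 0"
  shows "x \<in> E"
proof -
  have "orthogonal x w" if "w \<in> span (v ` {1..m})" for w
  proof (rule orthogonal_to_span[OF that])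
    fix y assume "y \<in> v ` {1..m}"
    then show "orthogonal x y"
      using assms(3) by (metis imageE inner_commute orthogonal_def)
  qed
  moreover have "orthogonal_comp E = span (v ` {1..m})"
    using assms(2) by (simp add: orthonormal_basis_def)
  ultimately have "x \<in> orthogonal_comp (orthogonal_comp E)"
    unfolding orthogonal_comp_def[of "orthogonal_comp E"] by (simp add: orthogonal_commute)
  with assms(1) show ?thesis by (simp add: orthogonal_comp_self)
qed

lemma comp_basis_orthogonal:
  assumes "orthonormal_basis v m (orthogonal_comp E)" "s \<in> {1..m}" "x \<in> E"
  shows "v s \<bullet> x = 0"
proof -
  have "v s \<in> orthogonal_comp E"
    using assms(1,2) unfolding orthonormal_basis_def by (auto intro!: span_base)
  with assms(3) show ?thesis by (simp add: orthogonal_comp_def orthogonal_def inner_commute)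
qed

lemma orthonormal_basis_mem: "orthonormal_basis u n E \<Longrightarrow> r \<in> {1..n} \<Longrightarrow> u r \<in> E"
  unfolding orthonormal_basis_def by (auto intro!: span_base)

text \<open>
  The constraints on the entries \<open>v\<^sub>s \<bullet> f u\<^sub>r\<close> and \<open>v\<^sub>t \<bullet> f v\<^sub>s\<close> put the range of \<open>f\<close> into \<open>E\<close>; given this, the
  entries \<open>u\<^sub>t \<bullet> f u\<^sub>r\<close> determine \<open>f\<close> on \<open>E\<close> and force it to be the identity there. The entries
  \<open>u\<^sub>r \<bullet> f v\<^sub>s\<close> parametrize the projections onto \<open>E\<close>.
\<close>

lemma projection_iff_orthonormal_entries:
  fixes E :: "'a::euclidean_space set"
  assumes E: "subspace E" and u: "orthonormal_basis u n E"
    and v: "orthonormal_basis v m (orthogonal_comp E)" and f: "linear f"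
  shows "is_projection_onto f E \<longleftrightarrow>
    (\<forall>r\<in>{1..n}. \<forall>r'\<in>{1..n}. u r' \<bullet> f (u r) = (if r = r' then 1 else 0)) \<and>
    (\<forall>s\<in>{1..m}. \<forall>s'\<in>{1..m}. v s' \<bullet> f (v s) = 0) \<and>
    (\<forall>r\<in>{1..n}. \<forall>s\<in>{1..m}. v s \<bullet> f (u r) = 0)" (is "_ \<longleftrightarrow> ?entries")
proof -
  note uE = orthonormal_basis_mem[OF u] and vE = comp_basis_orthogonal[OF v]
  show ?thesis
  proof
    assume "is_projection_onto f E"
    then have fE: "\<And>x. x \<in> E \<Longrightarrow> f x = x" and range_f: "\<And>x. f x \<in> E"
      by (simp_all add: is_projection_onto_iff[OF f])
    show ?entries
    proof (intro conjI ballI)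
      fix r r' assume "r \<in> {1..n}" "r' \<in> {1..n}"
      then show "u r' \<bullet> f (u r) = (if r = r' then 1 else 0)"
        using u by (simp add: fE[OF uE] orthonormal_basis_def)
    qed (simp_all add: vE range_f)
  next
    assume entries: ?entries
    have fu: "f (u r) = u r" if r: "r \<in> {1..n}" for r
    proof -
      have "f (u r) \<in> E"
        using entries r by (intro mem_if_orthogonal_to_comp_basis[OF E v]) auto
      then have in_E: "f (u r) - u r \<in> span (u ` {1..n})"
        using uE[OF r] u subspace_diff[OF E] by (simp add: orthonormal_basis_def)
      have "u r' \<bullet> (f (u r) - u r) = 0" if "r' \<in> {1..n}" for r'
      proof -
        have "u r' \<bullet> f (u r) = u r' \<bullet> u r"
          using entries r that u by (simp add: orthonormal_basis_def)
        then show ?thesis by (simp add: inner_diff_right)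
      qed
      then have "orthogonal (f (u r) - u r) y" if "y \<in> u ` {1..n}" for y
        using that by (metis imageE inner_commute orthogonal_def)
      then have "orthogonal (f (u r) - u r) (f (u r) - u r)"
        by (rule orthogonal_to_span[OF in_E])
      then show ?thesis by (simp add: orthogonal_self)
    qed
    have fE: "f x = x" if "x \<in> E" for x
    proof (rule linear_eq_on_span[OF f linear_ident])
      show "x \<in> span (u ` {1..n})" using that u by (simp add: orthonormal_basis_def)
    qed (use fu in auto)
    have "f ` orthogonal_comp E \<subseteq> E"
    proof -
      have "f (v s) \<in> E" if "s \<in> {1..m}" for s
        using entries that by (intro mem_if_orthogonal_to_comp_basis[OF E v]) auto
      then have "span (f ` v ` {1..m}) \<subseteq> E" by (intro span_minimal E) auto
      with v show ?thesis
        by (simp only: orthonormal_basis_def linear_span_image[OF f])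
    qed
    moreover have "\<exists>y\<in>E. \<exists>z\<in>orthogonal_comp E. x = y + z" for x
      using subspace_sum_orthogonal_comp[OF E] set_plus_elim[of x E "orthogonal_comp E"] by blast
    ultimately have "f x \<in> E" for x
      by (metis E f fE image_subset_iff linear_add subspace_add)
    with fE show "is_projection_onto f E" by (simp add: is_projection_onto_iff[OF f])
  qed
qed

section \<open>The linear program\<close>

text \<open>
  The right-hand side is given by positions, whereas the meaning of a constraint depends on the matrix
  at that position. Since the enumeration is injective, the two agree once it is known that the
  first \<open>n\<close> positions exist and that no matrix of the list other than the \<open>u\<^sub>r u\<^sub>r\<^sup>T\<close> coincides
  with one of the \<open>u\<^sub>i u\<^sub>i\<^sup>T\<close>; the function \<open>c\<close> is the right-hand side in terms of the matrices.
\<close>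

lemma constraints_iff_projection:
  fixes E :: "(real^'d) set" and X :: "real^'d^'d"
  assumes E: "subspace E" and u: "orthonormal_basis u n E"
    and v: "orthonormal_basis v m (orthogonal_comp E)"
    and B: "bij_betw B {1..p}
           ({outer (u r) (u r') | r r'. r \<in> {1..n} \<and> r' \<in> {1..n}} \<union>
            {outer (v s) (v s') | s s'. s \<in> {1..m} \<and> s' \<in> {1..m}} \<union>
            {outer (u r) (v s) | r s. r \<in> {1..n} \<and> s \<in> {1..m}})"
           (is "bij_betw B _ ?S")
    and diag: "\<And>i. i \<in> {1..n} \<Longrightarrow> B i = outer (u i) (u i)"
  shows "(\<forall>i\<in>{1..p}. trace (B i ** X) = (if i \<in> {1..n} then 1 else 0))
    \<longleftrightarrow> is_projection_onto ((*v) X) E"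
proof -
  define c :: "real^'d^'d \<Rightarrow> real" where "c Y = (if Y \<in> B ` {1..n} then 1 else 0)" for Y
  note cross = comp_basis_orthogonal[OF v _ orthonormal_basis_mem[OF u]]
  \<comment> \<open>If \<open>y z\<^sup>T = u\<^sub>i u\<^sub>i\<^sup>T\<close>, both have the same trace pairing with the identity and with \<open>u\<^sub>i u\<^sub>i\<^sup>T\<close>. The
      first pairing rules out \<open>u\<^sub>r u\<^sub>t\<^sup>T\<close> for \<open>r \<noteq> t\<close>, the second one every matrix that involves some \<open>v\<^sub>s\<close>.\<close>
  have sep: "z \<bullet> y = 1 \<and> (z \<bullet> u i) * (u i \<bullet> y) = 1"
    if "outer y z = B i" "i \<in> {1..n}" for i y z
  proof -
    have ui: "u i \<bullet> u i = 1" using u that(2) by (simp add: orthonormal_basis_def)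
    have eq: "z \<bullet> (Y *v y) = u i \<bullet> (Y *v u i)" for Y
      using that by (metis diag trace_outer_mult)
    have "outer (u i) (u i) *v w = (u i \<bullet> w) *\<^sub>R u i" for w
      by (simp add: outer_mult_vector)
    then show ?thesis using eq[of "mat 1"] eq[of "outer (u i) (u i)"] ui by (simp add: mult.commute)
  qed
  have c_uu: "c (outer (u r) (u r')) = (if r = r' then 1 else 0)" if "r \<in> {1..n}" "r' \<in> {1..n}" for r r'
  proof (cases "r = r'")
    case True
    have "outer (u r) (u r) \<in> B ` {1..n}"
      using imageI[OF that(1), of B] unfolding diag[OF that(1)] .
    with True show ?thesis by (simp add: c_def)
  next
    case False
    then have "u r' \<bullet> u r \<noteq> 1" using that u by (simp add: orthonormal_basis_def)
    then have "outer (u r) (u r') \<notin> B ` {1..n}" by (metis imageE sep)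
    with False show ?thesis by (simp add: c_def)
  qed
  have c_vv: "c (outer (v s) (v s')) = 0" if "s \<in> {1..m}" "s' \<in> {1..m}" for s s'
    using that sep[of "v s" "v s'"] cross unfolding c_def by force
  have c_uv: "c (outer (u r) (v s)) = 0" if "r \<in> {1..n}" "s \<in> {1..m}" for r s
    using that sep[of "u r" "v s"] cross unfolding c_def by force
  have "inj_on B {1..n}"
  proof (rule inj_onI)
    fix i k assume ik: "i \<in> {1..n}" "k \<in> {1..n}" "B i = B k"
    then have "u i \<bullet> u k \<noteq> 0" using sep[of "u i" "u i" k] diag by auto
    with ik u show "i = k" by (auto simp: orthonormal_basis_def split: if_splits)
  qed
  moreover have "B ` {1..n} \<subseteq> B ` {1..p}"
  proof (rule image_subsetI)
    fix i assume i: "i \<in> {1..n}"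
    then have "outer (u i) (u i) \<in> ?S" by blast
    then show "B i \<in> B ` {1..p}" unfolding diag[OF i] bij_betw_imp_surj_on[OF B] .
  qed
  \<comment> \<open>Without \<open>n \<le> p\<close>, injectivity of \<open>B\<close> on \<open>{1..p}\<close> would not suffice to
      compare a position in \<open>{1..p}\<close> with those in \<open>{1..n}\<close>.\<close>
  ultimately have "n \<le> p"
    using card_image[of B "{1..n}"] surj_card_le[of "{1..p}" "B ` {1..n}" B] by simp
  then have rhs: "(if i \<in> {1..n} then 1 else 0) = c (B i)" if "i \<in> {1..p}" for i
    unfolding c_def
    using inj_on_image_mem_iff[OF bij_betw_imp_inj_on[OF B] that, of "{1..n}"] by simp
  have "(\<forall>i\<in>{1..p}. trace (B i ** X) = (if i \<in> {1..n} then 1 else 0))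
      \<longleftrightarrow> (\<forall>Y\<in>B ` {1..p}. trace (Y ** X) = c Y)"
    using rhs by simp
  also have "B ` {1..p} = ?S" using B by (rule bij_betw_imp_surj_on)
  also have "(\<forall>Y\<in>?S. trace (Y ** X) = c Y) \<longleftrightarrow>
    (\<forall>r\<in>{1..n}. \<forall>r'\<in>{1..n}. trace (outer (u r) (u r') ** X) = c (outer (u r) (u r'))) \<and>
    (\<forall>s\<in>{1..m}. \<forall>s'\<in>{1..m}. trace (outer (v s) (v s') ** X) = c (outer (v s) (v s'))) \<and>
    (\<forall>r\<in>{1..n}. \<forall>s\<in>{1..m}. trace (outer (u r) (v s) ** X) = c (outer (u r) (v s)))"
    by blast
  also have "\<dots> \<longleftrightarrow> is_projection_onto ((*v) X) E"
    unfolding projection_iff_orthonormal_entries[OF E u v matrix_vector_mul_linear]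
    by (simp add: trace_outer_mult c_uu c_vv c_uv)
  finally show ?thesis .
qed

lemma trace_mult_sum_scaleR:
  fixes Y :: "real^'d^'d"
  shows "(\<Sum>k\<in>I. trace (Y ** e k) * x k) = trace (Y ** (\<Sum>k\<in>I. x k *\<^sub>R e k))"
proof -
  have lin: "linear (\<lambda>X::real^'d^'d. trace (Y ** X))"
    by (intro linearI)
       (simp_all add: trace_def matrix_matrix_mult_def ring_distribs sum.distrib sum_distrib_left
         ac_simps)
  show ?thesis
    using linear_sum[OF lin, of "\<lambda>k. x k *\<^sub>R e k" I] by (simp add: linear_scale[OF lin] mult.commute)
qed

theorem lemma5p1:
  fixes N :: "real^'d \<Rightarrow> real"
    and E :: "(real^'d) set"
    and u v :: "nat \<Rightarrow> real^'d"
    and B Ext :: "nat \<Rightarrow> real^'d^'d"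
    and n p q :: nat
    and A :: "nat \<Rightarrow> nat \<Rightarrow> real"
    and b :: "nat \<Rightarrow> real"
  assumes "polyhedral_norm N"
    and "subspace E" and "E \<noteq> {0}" and "E \<noteq> UNIV"
    and "n = dim E"
    and "orthonormal_basis u n E"
    and "orthonormal_basis v (CARD('d) - n) (orthogonal_comp E)"
    and "bij_betw B {1..p}
           ({outer (u r) (u r') | r r'. r \<in> {1..n} \<and> r' \<in> {1..n}} \<union>
            {outer (v s) (v s') | s s'. s \<in> {1..CARD('d) - n} \<and> s' \<in> {1..CARD('d) - n}} \<union>
            {outer (u r) (v s) | r s. r \<in> {1..n} \<and> s \<in> {1..CARD('d) - n}})"
    and "\<And>i. i \<in> {1..n} \<Longrightarrow> B i = outer (u i) (u i)"
    and "bij_betw Ext {1..q} {X. X extreme_point_of operator_unit_ball N}"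
    and "A = (\<lambda>i k. trace (B i ** Ext k))"
    and "b = (\<lambda>i. if i \<in> {1..n} then 1 else 0)"
  shows "lp_solvable p q A b (\<lambda>_. 1) \<and> lp_value p q A b (\<lambda>_. 1) = projection_constant N E"
proof -
  let ?M = "\<lambda>X::real^'d^'d. op_norm N N ((*v) X)"
  let ?C = "{X::real^'d^'d. is_projection_onto ((*v) X) E}"
  let ?X = "\<lambda>x. \<Sum>k=1..q. x k *\<^sub>R Ext k"
  note E = assms(2) and u = assms(6) and v = assms(7)
  have N: "is_norm N" using assms(1) by (simp add: polyhedral_norm_def)
  note M = is_norm_op_norm[OF N]
  have Ext: "bij_betw Ext {1..q} {X. X extreme_point_of {Y. ?M Y \<le> 1}}"
    using assms(10) by (simp add: operator_unit_ball_def)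
  have Ext_le: "?M (Ext k) \<le> 1" if "k \<in> {1..q}" for k
    using bij_betw_apply[OF Ext that] by (auto simp: extreme_point_of_def)

  have feasible_iff: "x \<in> lp_feasible p q A b \<longleftrightarrow> ?X x \<in> ?C \<and> (\<forall>k\<in>{1..q}. 0 \<le> x k)" for x
  proof -
    have "(\<Sum>k=1..q. A i k * x k) = trace (B i ** ?X x)" for i
      unfolding assms(11) by (rule trace_mult_sum_scaleR)
    then show ?thesis
      using constraints_iff_projection[OF E u v assms(8,9)]
      by (auto simp: lp_feasible_def assms(12))
  qed

  obtain P where P: "P \<in> ?C" "\<And>Y. Y \<in> ?C \<Longrightarrow> ?M P \<le> ?M Y"
    using norm_attains_min_on_closed[OF M closed_projection_matrices[OF E]]
      projection_matrix_exists[OF E] by (metis (no_types, lifting) empty_iff mem_Collect_eq)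
  obtain x where x: "\<And>k. k \<in> {1..q} \<Longrightarrow> 0 \<le> x k" "?X x = P" "sum x {1..q} = ?M P"
    using norm_eq_weight[OF M finite_atLeastAtMost Ext] by blast
  have x_feasible: "x \<in> lp_feasible p q A b" using P(1) x(1,2) by (simp add: feasible_iff)
  have x_value: "lp_objective q (\<lambda>_. 1) x = ?M P" using x(3) by (simp add: lp_objective_def)
  have x_min: "?M P \<le> lp_objective q (\<lambda>_. 1) y" if "y \<in> lp_feasible p q A b" for y
  proof -
    have "?M P \<le> ?M (?X y)" using that P(2) by (simp add: feasible_iff)
    also have "\<dots> \<le> sum y {1..q}"
      using that by (intro norm_le_weight[OF M] Ext_le) (auto simp: feasible_iff)
    finally show ?thesis by (simp add: lp_objective_def)
  qed
  have "lp_value p q A b (\<lambda>_. 1) = ?M P"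
    unfolding lp_value_def
    by (rule cInf_eq_minimum) (use x_feasible x_value x_min in \<open>auto intro: rev_image_eqI\<close>)
  moreover have "projection_constant N E = ?M P"
    unfolding projection_constant_eq_matrix_INF
    by (rule cInf_eq_minimum) (use P in auto)
  moreover have "lp_solvable p q A b (\<lambda>_. 1)"
    unfolding lp_solvable_def using x_min x_value by (intro bexI[OF _ x_feasible] ballI) simp
  ultimately show ?thesis by simp
qed

end
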